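(* Let $\alpha_1,\alpha_2\ge0$ and let $r_i^{\oplus},\ell_i^{\oplus},b_i^{\oplus},r_i^{\ominus},\ell_i^{\ominus},b_i^{\ominus}:\mathcal S\to[0,\infty)$ $(i\in\mathbb Z)$ be rate functions as in the context. Assume that $$\sup_{i\in\mathbb Z,\,y\in\mathcal S:\,y_i\neq0}\big[r_i^{\oplus}(y)+\ell_i^{\oplus}(y)+r_i^{\ominus}(y)+\ell_i^{\ominus}(y)\big]\le1,$$ that there are constants $B_n\in[0,\infty)$ $(n\in\mathbb Z^+)$ such that for every $n$ $$\sup_{i\in\mathbb Z,\,y\in\mathcal S:\,|y|=n}\big[b_i^{\oplus}(y)+b_i^{\ominus}(y)\big]\le B_n,$$ and that, with $B(N)=\max_{1\le n\le N}(n\,B_n)$, $\sum_{N=1}^{+\infty}\frac1{B(N)}=+\infty$ (with $1/0=+\infty$). Then for every initial configuration $Y_0\in\mathcal S$ the process $(Y(t))_{t\ge0}$ takes almost surely only finitely many steps in every finite time interval. In particular $Y(t)\in\mathcal S$ for every $t>0$.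
   Context: $\mathcal S$ is the countable set of $y\in\{-1,0,+1\}^{\mathbb Z}$ such that $|y|:=\sum_i|y_i|$ is finite and odd and the nonzero entries of $y$ alternate in sign. A coordinate $y_i=+1$ ($-1$) is a positive (negative) particle at $i$. $\delta_i$ is the configuration equal to $1$ at $i$ and $0$ elsewhere. Rate convention: $r_i^{\oplus}(y)=\ell_i^{\oplus}(y)=b_i^{\oplus}(y)=0$ unless $y_i=+1$, and $r_i^{\ominus}(y)=\ell_i^{\ominus}(y)=b_i^{\ominus}(y)=0$ unless $y_i=-1$. Double branching annihilating random walk $(Y(t))_{t\ge0}$: the continuous time Markov jump process (a priori constructed only up to a possible explosion time, i.e. accumulation of jumps) started from $Y(0)=Y_0\in\mathcal S$, with the following transitions from $y\in\mathcal S$, for each $i\in\mathbb Z$ (rates of coinciding transitions add up). If $y_i=+1$: to $y-\delta_i+\delta_{i+1}$ at rate $\alpha_1r_i^{\oplus}(y)$; to $y+\delta_{i-1}-\delta_i$ at rate $\alpha_1\ell_i^{\oplus}(y)$; to $y+\delta_{i-1}-2\delta_i+\delta_{i+1}$ at rate $\alpha_2b_i^{\oplus}(y)$. If $y_i=-1$: to $y+\delta_i-\delta_{i+1}$ at rate $\alpha_1r_i^{\ominus}(y)$; to $y-\delta_{i-1}+\delta_i$ at rate $\alpha_1\ell_i^{\ominus}(y)$; to $y-\delta_{i-1}+2\delta_i-\delta_{i+1}$ at rate $\alpha_2b_i^{\ominus}(y)$. "Steps" are the jumps of this process.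
   Formalization: If B_1 = 0, every tail of the series of 1/B(N) is also required to diverge; otherwise the term 1/B(1) = 1/0 = +∞ makes the series diverge for any B_n with n ≥ 2, and the claim fails (e.g. B_n = e^n for n ≥ 2 allows explosion from + − +). *)

theory Defs
  imports "HOL-Probability.Probability"
begin

definition alternating :: "(int \<Rightarrow> int) \<Rightarrow> bool" where
  "alternating y \<longleftrightarrow>
     (\<forall>i j. i < j \<longrightarrow> y i \<noteq> 0 \<longrightarrow> y j \<noteq> 0 \<longrightarrow> (\<forall>k. i < k \<and> k < j \<longrightarrow> y k = 0) \<longrightarrow> y j = - y i)"

(* The number |y|. It is the junk value 0 if y has infinitely many nonzero entries, so
   finiteness is required separately in configs. *)
definition particles :: "(int \<Rightarrow> int) \<Rightarrow> nat" where
  "particles y = (\<Sum>i | y i \<noteq> 0. nat \<bar>y i\<bar>)"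

definition configs :: "(int \<Rightarrow> int) set" where
  "configs = {y. range y \<subseteq> {-1, 0, 1} \<and> finite {i. y i \<noteq> 0} \<and> odd (particles y) \<and> alternating y}"

definition unit_at :: "int \<Rightarrow> int \<Rightarrow> int" where
  "unit_at i j = of_bool (j = i)"

(* Rate of the transition from y to z: the contributions of all particles i of y are summed, so
   that coinciding transitions have their rates added. *)
definition dbarw_rate ::
  "real \<Rightarrow> real \<Rightarrow>
   (int \<Rightarrow> (int \<Rightarrow> int) \<Rightarrow> real) \<Rightarrow> (int \<Rightarrow> (int \<Rightarrow> int) \<Rightarrow> real) \<Rightarrow> (int \<Rightarrow> (int \<Rightarrow> int) \<Rightarrow> real) \<Rightarrow>
   (int \<Rightarrow> (int \<Rightarrow> int) \<Rightarrow> real) \<Rightarrow> (int \<Rightarrow> (int \<Rightarrow> int) \<Rightarrow> real) \<Rightarrow> (int \<Rightarrow> (int \<Rightarrow> int) \<Rightarrow> real) \<Rightarrow>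
   (int \<Rightarrow> int) \<Rightarrow> (int \<Rightarrow> int) \<Rightarrow> real" where
  "dbarw_rate \<alpha>1 \<alpha>2 rp lp bp rm lm bm y z =
     (\<Sum>i | y i = 1.
         \<alpha>1 * rp i y * of_bool (z = (\<lambda>j. y j - unit_at i j + unit_at (i + 1) j))
       + \<alpha>1 * lp i y * of_bool (z = (\<lambda>j. y j + unit_at (i - 1) j - unit_at i j))
       + \<alpha>2 * bp i y * of_bool (z = (\<lambda>j. y j + unit_at (i - 1) j - 2 * unit_at i j + unit_at (i + 1) j)))
   + (\<Sum>i | y i = -1.
         \<alpha>1 * rm i y * of_bool (z = (\<lambda>j. y j + unit_at i j - unit_at (i + 1) j))
       + \<alpha>1 * lm i y * of_bool (z = (\<lambda>j. y j - unit_at (i - 1) j + unit_at i j))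
       + \<alpha>2 * bm i y * of_bool (z = (\<lambda>j. y j - unit_at (i - 1) j + 2 * unit_at i j - unit_at (i + 1) j)))"

(* Total jump rate out of x, for a jump process on S with transition rates q. For rates that are
   not summable over S the infinite sum has a junk value; for y in configs, the rates out of y
   given by dbarw_rate vanish outside a finite set of targets. *)
definition exit_rate :: "'s set \<Rightarrow> ('s \<Rightarrow> 's \<Rightarrow> real) \<Rightarrow> 's \<Rightarrow> real" where
  "exit_rate S q x = (\<Sum>\<^sub>\<infinity>z\<in>S. q x z)"

definition jump_prob :: "'s set \<Rightarrow> ('s \<Rightarrow> 's \<Rightarrow> real) \<Rightarrow> 's \<Rightarrow> 's \<Rightarrow> real" where
  "jump_prob S q x z = (if exit_rate S q x = 0 then of_bool (z = x) else q x z / exit_rate S q x)"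

(* A Markov jump process on the countable set S with transition rates q, started from x0 and
   described by its jump chain X and its holding times T: X is a Markov chain with transition
   matrix jump_prob S q and, conditionally on X, the T k are independent and exponentially
   distributed with parameters exit_rate S q (X k). In an absorbing state (exit rate 0) the law
   below forces T k = \<infinity> almost surely, and the chain formally stays where it is. *)
definition markov_jump_process ::
  "'w measure \<Rightarrow> 's set \<Rightarrow> ('s \<Rightarrow> 's \<Rightarrow> real) \<Rightarrow> 's \<Rightarrow> (nat \<Rightarrow> 'w \<Rightarrow> 's) \<Rightarrow> (nat \<Rightarrow> 'w \<Rightarrow> ennreal) \<Rightarrow> bool"
  where
  "markov_jump_process M S q x0 X T \<longleftrightarrow>
     prob_space M \<and>
     (\<forall>n. X n \<in> measurable M (count_space S)) \<and>
     (\<forall>n. T n \<in> borel_measurable M) \<and>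
     (\<forall>n x t. (\<forall>k\<le>n. x k \<in> S) \<longrightarrow> (\<forall>k<n. 0 \<le> t k) \<longrightarrow>
        measure M {\<omega> \<in> space M. (\<forall>k\<le>n. X k \<omega> = x k) \<and> (\<forall>k<n. ennreal (t k) < T k \<omega>)} =
        of_bool (x 0 = x0) *
        (\<Prod>k<n. jump_prob S q (x k) (x (Suc k)) * exp (- exit_rate S q (x k) * t k)))"

(* Time of the n-th jump (n > 0); it is \<infinity> if there are fewer than n jumps. *)
definition jump_time :: "(nat \<Rightarrow> 'w \<Rightarrow> ennreal) \<Rightarrow> nat \<Rightarrow> 'w \<Rightarrow> ennreal" where
  "jump_time T n \<omega> = (\<Sum>k<n. T k \<omega>)"

(* The state at time t; None from the explosion time (the supremum of the jump times) on. *)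
definition jump_path ::
  "(nat \<Rightarrow> 'w \<Rightarrow> 's) \<Rightarrow> (nat \<Rightarrow> 'w \<Rightarrow> ennreal) \<Rightarrow> real \<Rightarrow> 'w \<Rightarrow> 's option" where
  "jump_path X T t \<omega> =
     (if \<exists>n. jump_time T n \<omega> \<le> ennreal t \<and> ennreal t < jump_time T (Suc n) \<omega>
      then Some (X (THE n. jump_time T n \<omega> \<le> ennreal t \<and> ennreal t < jump_time T (Suc n) \<omega>) \<omega>)
      else None)"

definition max_branching :: "(nat \<Rightarrow> real) \<Rightarrow> nat \<Rightarrow> real" where
  "max_branching B N = Max ((\<lambda>n. real n * B n) ` {1..N})"

end

theory Submission
  imports Defs
begin

text \<open>
  Put \<open>f n = (\<Sum>m<n. 1 / (1 + max_branching B (Suc m)))\<close>, which is increasing and, by the divergence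
  assumption, unbounded. Only branching increases the number of particles, by at most 2, at total
  rate at most \<open>\<alpha>2 * n * B n\<close>, so the drift of \<open>W y = 1 + f (particles y)\<close> is at most \<open>2 * \<alpha>2\<close>.

  For a jump process with exit rates \<open>E\<close> and a function \<open>W \<ge> 1\<close> with drift at most \<open>c * W\<close>, the products
  \<open>(\<Prod>k<n. (1 + 1 / (E (X k) + c)) * exp (- (c + 1) * T k)) * W (X n)\<close> form a supermartingale. By Fatou
  their lower limit is almost surely finite. If \<open>\<Sum>k. T k\<close> is finite, the exponential factors stay away
  from 0, so \<open>W (X n)\<close> is bounded along a subsequence and \<open>\<Prod>k. 1 + 1 / (E (X k) + c)\<close> converges. This
  is impossible if \<open>E\<close> is bounded on the sublevel sets of \<open>W\<close>.
\<close>

section \<open>Laplace transforms of exponential times\<close>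

text \<open>The value 0 at \<open>T = 0\<close> is chosen because \<^const>\<open>markov_jump_process\<close> prescribes only the
  probabilities of events \<open>t < T\<close> with \<open>t \<ge> 0\<close>.\<close>

definition discount :: "real \<Rightarrow> ennreal \<Rightarrow> ennreal" where
  "discount c T = (if 0 < T \<and> T < \<top> then ennreal (exp (- c * enn2real T)) else 0)"

lemma measurable_discount [measurable]: "discount c \<in> borel_measurable borel"
  unfolding discount_def by measurable

text \<open>For finite \<open>T\<close> this says that 1 - exp(-c T) is the integral of c exp(-c t)
  over 0 <= t < T, with the subtraction moved to the other side because it is truncated in
  \<open>ennreal\<close>. The values of \<open>discount\<close> at 0 and at infinity make the
  identity hold for every \<open>T\<close>.\<close>

lemma discount_layer_cake:
  assumes "0 < c"
  shows "discount c T + (\<integral>\<^sup>+t. ennreal (c * exp (- c * t)) * indicator {t. 0 \<le> t \<and> ennreal t < T} t \<partial>lborel)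
    = indicator {0<..} T"
proof (cases T)
  case (real s)
  have "(\<integral>\<^sup>+t. ennreal (c * exp (- c * t)) * indicator {t. 0 \<le> t \<and> ennreal t < T} t \<partial>lborel)
      = (\<integral>\<^sup>+t. ennreal (c * exp (- c * t)) * indicator {0..s} t \<partial>lborel)"
  proof (rule nn_integral_cong_AE)
    show "AE t in lborel. ennreal (c * exp (- c * t)) * indicator {t. 0 \<le> t \<and> ennreal t < T} t
      = ennreal (c * exp (- c * t)) * indicator {0..s} t"
      using AE_lborel_singleton[of s]
      by eventually_elim (use real in \<open>auto simp: indicator_def ennreal_less_iff\<close>)
  qed
  also have "\<dots> = ennreal (- exp (- c * s) - (- exp (- c * 0)))"
    using real \<open>0 < c\<close>
    by (intro nn_integral_FTC_Icc) (auto intro!: derivative_eq_intros)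
  finally show ?thesis
    using real \<open>0 < c\<close> by (auto simp: discount_def indicator_def ennreal_plus[symmetric] simp del: ennreal_plus)
next
  case top
  have "(\<integral>\<^sup>+t. ennreal (c * exp (- c * t)) * indicator {0..} t \<partial>lborel) = ennreal (0 - (- exp (- c * 0)))"
  proof (rule nn_integral_FTC_atLeast)
    show "((\<lambda>t. - exp (- c * t)) \<longlongrightarrow> 0) at_top"
      using \<open>0 < c\<close> by real_asymp
  qed (use \<open>0 < c\<close> in \<open>auto intro!: derivative_eq_intros\<close>)
  then show ?thesis
    using top by (simp add: discount_def atLeast_def)
qed

text \<open>Under the weight \<open>G\<close>, \<open>T\<close> behaves like an exponential time of
  rate \<open>r\<close> and total mass \<open>C\<close>, and the result is its Laplace transform at
  \<open>c\<close>: \<open>discount_layer_cake\<close> is integrated and the two integrals are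
  exchanged. For \<open>r = 0\<close> the mass on positive times sits at infinity, where
  \<open>discount\<close> vanishes.\<close>

lemma nn_integral_discount:
  fixes G :: "'w \<Rightarrow> ennreal" and T :: "'w \<Rightarrow> ennreal"
  assumes "sigma_finite_measure M"
    and [measurable]: "G \<in> borel_measurable M" "T \<in> borel_measurable M"
    and "0 < c" "0 \<le> r" "0 \<le> C"
    and tail: "\<And>t. 0 \<le> t \<Longrightarrow> (\<integral>\<^sup>+\<omega>. G \<omega> * indicator {ennreal t<..} (T \<omega>) \<partial>M) = ennreal (C * exp (- r * t))"
  shows "(\<integral>\<^sup>+\<omega>. G \<omega> * discount c (T \<omega>) \<partial>M) = ennreal (C * (r / (r + c)))"
proof -
  interpret sigma_finite_measure M by fact
  interpret P: pair_sigma_finite M lborel ..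
  let ?e = "\<lambda>t. ennreal (c * exp (- c * t))"
  have "(\<integral>\<^sup>+\<omega>. G \<omega> * (\<integral>\<^sup>+t. ?e t * indicator {t. 0 \<le> t \<and> ennreal t < T \<omega>} t \<partial>lborel) \<partial>M)
      = (\<integral>\<^sup>+\<omega>. (\<integral>\<^sup>+t. G \<omega> * (?e t * indicator {t. 0 \<le> t \<and> ennreal t < T \<omega>} t) \<partial>lborel) \<partial>M)"
    by (intro nn_integral_cong nn_integral_cmult[symmetric]) measurable
  also have "\<dots> = (\<integral>\<^sup>+t. (\<integral>\<^sup>+\<omega>. G \<omega> * (?e t * indicator {t. 0 \<le> t \<and> ennreal t < T \<omega>} t) \<partial>M) \<partial>lborel)"
    by (rule P.Fubini'[symmetric]) measurable
  also have "\<dots> = (\<integral>\<^sup>+t. ?e t * indicator {0..} t * (\<integral>\<^sup>+\<omega>. G \<omega> * indicator {ennreal t<..} (T \<omega>) \<partial>M) \<partial>lborel)"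
    by (subst nn_integral_cmult[symmetric])
      (auto intro!: nn_integral_cong simp: indicator_def mult_ac)
  also have "\<dots> = (\<integral>\<^sup>+t. ennreal (C * c * exp (- (c + r) * t)) * indicator {0..} t \<partial>lborel)"
  proof (intro nn_integral_cong)
    fix t :: real
    show "?e t * indicator {0..} t * (\<integral>\<^sup>+\<omega>. G \<omega> * indicator {ennreal t<..} (T \<omega>) \<partial>M)
        = ennreal (C * c * exp (- (c + r) * t)) * indicator {0..} t"
      using \<open>0 < c\<close> \<open>0 \<le> C\<close>
      by (cases "0 \<le> t") (auto simp: tail ennreal_mult[symmetric] exp_add[symmetric] algebra_simps exp_diff exp_minus divide_simps)
  qed
  also have "\<dots> = ennreal (0 - (- (C * c / (c + r)) * exp (- (c + r) * 0)))"
  proof (rule nn_integral_FTC_atLeast)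
    have "((\<lambda>t. exp (- (c + r) * t)) \<longlongrightarrow> 0) at_top"
      using \<open>0 < c\<close> \<open>0 \<le> r\<close> by real_asymp
    from tendsto_mult_right_zero[OF this]
    show "((\<lambda>t. - (C * c / (c + r)) * exp (- (c + r) * t)) \<longlongrightarrow> 0) at_top" .
    fix t :: real
    have "c + r \<noteq> 0"
      using \<open>0 < c\<close> \<open>0 \<le> r\<close> by simp
    then show "((\<lambda>t. - (C * c / (c + r)) * exp (- (c + r) * t)) has_real_derivative
        C * c * exp (- (c + r) * t)) (at t)"
      by (auto intro!: derivative_eq_intros simp del: minus_add_distrib)
  qed (use \<open>0 < c\<close> \<open>0 \<le> r\<close> \<open>0 \<le> C\<close> in auto)
  finally have int: "(\<integral>\<^sup>+\<omega>. G \<omega> * (\<integral>\<^sup>+t. ?e t * indicator {t. 0 \<le> t \<and> ennreal t < T \<omega>} t \<partial>lborel) \<partial>M)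
      = ennreal (C * c / (c + r))"
    by simp
  \<comment> \<open>The two parts are added instead of subtracted. Their sum is the mass of the
    event \<open>0 < T\<close>, read off from \<open>tail\<close> at time 0, and the finite second
    part is then cancelled.\<close>
  have "(\<integral>\<^sup>+\<omega>. G \<omega> * discount c (T \<omega>) \<partial>M) + ennreal (C * c / (c + r))
      = (\<integral>\<^sup>+\<omega>. G \<omega> * discount c (T \<omega>) + G \<omega> * (\<integral>\<^sup>+t. ?e t * indicator {t. 0 \<le> t \<and> ennreal t < T \<omega>} t \<partial>lborel) \<partial>M)"
    unfolding int[symmetric] by (rule nn_integral_add[symmetric]) measurable
  also have "\<dots> = (\<integral>\<^sup>+\<omega>. G \<omega> * indicator {ennreal 0<..} (T \<omega>) \<partial>M)"
    by (simp only: distrib_left[symmetric] discount_layer_cake[OF \<open>0 < c\<close>] ennreal_0)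
  also have "\<dots> = ennreal C"
    by (simp only: tail) simp
  finally have "(\<integral>\<^sup>+\<omega>. G \<omega> * discount c (T \<omega>) \<partial>M) + ennreal (C * c / (c + r))
      = ennreal (C * (r / (r + c))) + ennreal (C * c / (c + r))"
    using \<open>0 < c\<close> \<open>0 \<le> r\<close> \<open>0 \<le> C\<close>
    by (simp add: ennreal_plus[symmetric] add_divide_distrib[symmetric] distrib_left[symmetric] add.commute
        del: ennreal_plus)
  then show ?thesis
    by simp
qed

text \<open>The indicators are converted one at a time. Generalising over \<open>G\<close> and
  \<open>C\<close> lets a finished factor move into the weight and \<open>r j / (r j + c)\<close>
  into the constant, so that the tail hypothesis keeps its form for the remaining indices.\<close>

lemma nn_integral_prod_discount:
  fixes G :: "'w \<Rightarrow> ennreal" and T :: "'i \<Rightarrow> 'w \<Rightarrow> ennreal"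
  assumes "sigma_finite_measure M" "finite K"
    and "G \<in> borel_measurable M" "\<And>k. T k \<in> borel_measurable M"
    and "0 < c" "\<And>k. k \<in> K \<Longrightarrow> 0 \<le> r k" "0 \<le> C"
    and "\<And>t. (\<And>k. 0 \<le> t k) \<Longrightarrow>
      (\<integral>\<^sup>+\<omega>. G \<omega> * (\<Prod>k\<in>K. indicator {ennreal (t k)<..} (T k \<omega>)) \<partial>M) = ennreal (C * (\<Prod>k\<in>K. exp (- r k * t k)))"
  shows "(\<integral>\<^sup>+\<omega>. G \<omega> * (\<Prod>k\<in>K. discount c (T k \<omega>)) \<partial>M) = ennreal (C * (\<Prod>k\<in>K. r k / (r k + c)))"
  using assms(2-)
proof (induction K arbitrary: G C rule: finite_induct)
  case empty
  then show ?case by simp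
next
  case (insert j K)
  note [measurable] = insert.prems(1,2)
  have "(\<integral>\<^sup>+\<omega>. (G \<omega> * discount c (T j \<omega>)) * (\<Prod>k\<in>K. indicator {ennreal (t k)<..} (T k \<omega>)) \<partial>M)
      = ennreal (C * (r j / (r j + c)) * (\<Prod>k\<in>K. exp (- r k * t k)))" if "\<And>k. 0 \<le> t k" for t
  proof -
    have "(\<integral>\<^sup>+\<omega>. G \<omega> * (\<Prod>k\<in>K. indicator {ennreal (t k)<..} (T k \<omega>)) * indicator {ennreal s<..} (T j \<omega>) \<partial>M)
        = ennreal (C * (\<Prod>k\<in>K. exp (- r k * t k)) * exp (- r j * s))" if "0 \<le> s" for s
    proof -
      \<comment> \<open>As \<open>j\<close> lies outside \<open>K\<close>, the threshold of
        \<open>T j\<close> can be varied alone without changing the other factors.\<close>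
      have "(\<Prod>k\<in>K. indicator {ennreal ((t(j := s)) k)<..} (T k \<omega>)) = (\<Prod>k\<in>K. indicator {ennreal (t k)<..} (T k \<omega>) :: ennreal)"
        "(\<Prod>k\<in>K. exp (- r k * (t(j := s)) k)) = (\<Prod>k\<in>K. exp (- r k * t k))" for \<omega>
        using insert.hyps by (auto intro!: prod.cong)
      then show ?thesis
        using insert.prems(6)[of "t(j := s)"] that \<open>\<And>k. 0 \<le> t k\<close> insert.hyps
        by (simp add: mult_ac)
    qed
    then have "(\<integral>\<^sup>+\<omega>. G \<omega> * (\<Prod>k\<in>K. indicator {ennreal (t k)<..} (T k \<omega>)) * discount c (T j \<omega>) \<partial>M)
        = ennreal (C * (\<Prod>k\<in>K. exp (- r k * t k)) * (r j / (r j + c)))"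
      by (intro nn_integral_discount[OF assms(1)])
        (use insert.prems(3-5) in \<open>auto intro!: prod_nonneg mult_nonneg_nonneg\<close>)
    then show ?thesis by (simp add: mult_ac)
  qed
  then have "(\<integral>\<^sup>+\<omega>. (G \<omega> * discount c (T j \<omega>)) * (\<Prod>k\<in>K. discount c (T k \<omega>)) \<partial>M)
      = ennreal (C * (r j / (r j + c)) * (\<Prod>k\<in>K. r k / (r k + c)))"
    by (intro insert.IH) (use insert.prems(3-5) in auto)
  then show ?case
    using insert.hyps by (simp add: mult_ac)
qed

section \<open>A Foster--Lyapunov criterion for non-explosion\<close>

text \<open>The pathwise half of the criterion, free of probability: along one trajectory,
  \<open>a\<close> stands for the exit rates, \<open>W\<close> for the values of the Lyapunov
  function and \<open>liminf\<close> for the outcome of Fatou's lemma. Since \<open>c < d\<close>,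
  every factor \<open>(a k + d) / (a k + c)\<close> exceeds 1.\<close>

lemma infinite_holding_time_sum:
  fixes a W :: "nat \<Rightarrow> real" and T :: "nat \<Rightarrow> ennreal"
  assumes "0 < c"
    and a: "\<And>n. 0 \<le> a n" and W: "\<And>n. 1 \<le> W n" and T: "\<And>n. 0 < T n"
    and bounded: "\<And>w. \<exists>Q. \<forall>n. W n \<le> w \<longrightarrow> a n \<le> Q"
    and liminf: "liminf (\<lambda>n. (\<Prod>k<n. ennreal ((a k + d) / (a k + c)) * discount d (T k)) * ennreal (W n)) < \<infinity>"
    and "c < d"
  shows "(\<Sum>k. T k) = \<infinity>"
proof (rule ccontr)
  assume "(\<Sum>k. T k) \<noteq> \<infinity>"
  then obtain s where s: "0 \<le> s" "(\<Sum>k. T k) = ennreal s"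
    by (cases "\<Sum>k. T k") auto
  have "T k \<le> (\<Sum>k. T k)" for k
    using sum_le_suminf[of T "{k}"] by simp
  then have T_fin: "T k < \<top>" for k
    using s by (metis ennreal_less_top order_le_less_trans)
  define P where "P n = (\<Prod>k<n. (a k + d) / (a k + c))" for n
  have fac: "1 \<le> (a k + d) / (a k + c)" for k
    using a[of k] \<open>0 < c\<close> \<open>c < d\<close> by simp
  have P_ge_1: "1 \<le> P n" for n
    unfolding P_def by (intro prod_ge_1 fac)
  have P_mono: "P m \<le> P n" if "m \<le> n" for m n
    unfolding P_def using fac by (intro prod_mono2) (use that in \<open>auto intro: order_trans[OF zero_le_one]\<close>)
  \<comment> \<open>A finite total time \<open>s\<close> keeps every product of discounts at or
    above \<open>exp (- d * s)\<close>.\<close>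
  have lower: "ennreal (P n * exp (- d * s) * W n) \<le> (\<Prod>k<n. ennreal ((a k + d) / (a k + c)) * discount d (T k)) * ennreal (W n)" for n
  proof -
    have "(\<Sum>k<n. T k) \<le> ennreal s"
      unfolding s(2)[symmetric] by (rule sum_le_suminf) auto
    moreover have "ennreal (\<Sum>k<n. enn2real (T k)) = (\<Sum>k<n. T k)"
      using T_fin by (subst sum_ennreal[symmetric]) auto
    ultimately have "(\<Sum>k<n. enn2real (T k)) \<le> s"
      using s(1) by (metis ennreal_le_iff)
    then have "exp (- d * s) \<le> exp (\<Sum>k<n. - d * enn2real (T k))"
      using \<open>0 < c\<close> \<open>c < d\<close> by (simp add: sum_distrib_left[symmetric] sum_negf)
    moreover have "(\<Prod>k<n. discount d (T k)) = ennreal (exp (\<Sum>k<n. - d * enn2real (T k)))"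
      using T T_fin by (simp add: discount_def prod_ennreal exp_sum)
    ultimately have "ennreal (exp (- d * s)) \<le> (\<Prod>k<n. discount d (T k))"
      by simp
    moreover have "(\<Prod>k<n. ennreal ((a k + d) / (a k + c))) = ennreal (P n)"
      unfolding P_def using fac by (intro prod_ennreal) (auto intro: order_trans[OF zero_le_one])
    ultimately show ?thesis
      using P_ge_1[of n] W[of n] by (simp add: prod.distrib ennreal_mult mult_left_mono mult_right_mono)
  qed
  obtain b where b: "liminf (\<lambda>n. (\<Prod>k<n. ennreal ((a k + d) / (a k + c)) * discount d (T k)) * ennreal (W n)) < b" "b < \<infinity>"
    using liminf dense by blast
  from b(2) obtain K where "b = ennreal K"
    by (cases b) auto
  with b(1) have "\<exists>\<^sub>F n in sequentially. (\<Prod>k<n. ennreal ((a k + d) / (a k + c)) * discount d (T k)) * ennreal (W n) < ennreal K"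
    using Liminf_bounded[of "ennreal K" "\<lambda>n. (\<Prod>k<n. ennreal ((a k + d) / (a k + c)) * discount d (T k)) * ennreal (W n)" sequentially]
    by (auto simp: frequently_def not_less)
  then have "\<exists>\<^sub>F n in sequentially. ennreal (P n * exp (- d * s) * W n) < ennreal K"
    by (rule frequently_elim1) (rule order_le_less_trans[OF lower])
  define L where "L = K * exp (d * s)"
  have freq: "\<exists>\<^sub>F n in sequentially. P n * W n < L"
  proof (rule frequently_elim1)
    fix n assume "ennreal (P n * exp (- d * s) * W n) < ennreal K"
    then have "P n * exp (- d * s) * W n < K"
      using P_ge_1[of n] W[of n] by (simp add: ennreal_less_iff)
    then show "P n * W n < L"
      by (simp add: L_def exp_minus field_simps)
  qed fact
  \<comment> \<open>\<open>P\<close> is nondecreasing and \<open>W\<close> is at least 1, so an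
    index \<open>m\<close> beyond \<open>n\<close> with \<open>P m * W m < L\<close> also bounds
    \<open>P n\<close>.\<close>
  have P_le: "P n \<le> L" for n
  proof -
    obtain m where "n \<le> m" "P m * W m < L"
      using freq by (auto simp: frequently_sequentially)
    moreover have "P m * 1 \<le> P m * W m"
      using P_ge_1[of m] W[of m] by (intro mult_left_mono) auto
    ultimately show ?thesis using P_mono[of n m] by simp
  qed
  obtain Q where Q: "\<And>n. W n \<le> L \<Longrightarrow> a n \<le> Q"
    using bounded by blast
  \<comment> \<open>At the same indices \<open>1 \<le> P n\<close> bounds \<open>W n\<close> by
    \<open>L\<close>, hence the exit rates return below the fixed level \<open>Q\<close> infinitely
    often.\<close>
  have "\<exists>\<^sub>F n in sequentially. a n \<le> Q"
    using freq
  proof (rule frequently_elim1)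
    fix n assume "P n * W n < L"
    moreover have "1 * W n \<le> P n * W n"
      using P_ge_1[of n] W[of n] by (intro mult_right_mono) auto
    ultimately show "a n \<le> Q" by (intro Q) simp
  qed
  then have inf: "infinite {n. a n \<le> Q}"
    by (simp add: frequently_cofinite[symmetric] cofinite_eq_sequentially)
  then obtain n0 where "a n0 \<le> Q"
    using infinite_imp_nonempty by blast
  then have "0 < Q + c"
    using a[of n0] \<open>0 < c\<close> by simp
  \<comment> \<open>The value of the factor at \<open>a k = Q\<close>. The factor decreases in
    \<open>a k\<close>, so each of the infinitely many returns multiplies \<open>P\<close> by at
    least \<open>\<eta>\<close>, and \<open>m\<close> of them already exceed
    \<open>L\<close>.\<close>
  define \<eta> where "\<eta> = (Q + d) / (Q + c)"
  have "1 < \<eta>"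
    using \<open>0 < Q + c\<close> \<open>c < d\<close> by (simp add: \<eta>_def)
  then obtain m where m: "L < \<eta> ^ m"
    using real_arch_pow by blast
  obtain A where A: "A \<subseteq> {n. a n \<le> Q}" "finite A" "card A = m"
    using infinite_arbitrarily_large[OF inf] by blast
  obtain n where n: "A \<subseteq> {..<n}"
    using finite_nat_bounded[OF A(2)] by blast
  have "\<eta> ^ m = (\<Prod>k\<in>A. \<eta>)"
    using A by simp
  also have "\<dots> \<le> (\<Prod>k\<in>A. (a k + d) / (a k + c))"
  proof (intro prod_mono conjI)
    fix k assume "k \<in> A"
    then have "a k + c \<le> Q + c"
      using A by auto
    then have "(d - c) / (Q + c) \<le> (d - c) / (a k + c)"
      using a[of k] \<open>0 < c\<close> \<open>c < d\<close> by (intro divide_left_mono) auto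
    then show "\<eta> \<le> (a k + d) / (a k + c)"
      using a[of k] \<open>0 < c\<close> \<open>0 < Q + c\<close> unfolding \<eta>_def by (simp add: field_simps)
  qed (use \<open>1 < \<eta>\<close> in auto)
  also have "\<dots> \<le> P n"
    unfolding P_def using n fac by (intro prod_mono2) (auto intro: order_trans[OF zero_le_one])
  finally show False
    using m P_le[of n] by simp
qed

section \<open>Jump processes with finitely many targets per state, and integration over finite
  paths\<close>

text \<open>Finitely many targets make \<open>exit_rate\<close> a genuine finite sum, and
  countability of \<open>S\<close> allows sums over states to be exchanged with integrals over
  \<open>M\<close>.\<close>

locale finite_range_jump_process =
  fixes M :: "'w measure" and S :: "'s set" and q :: "'s \<Rightarrow> 's \<Rightarrow> real" and x0 :: 's
    and X :: "nat \<Rightarrow> 'w \<Rightarrow> 's" and T :: "nat \<Rightarrow> 'w \<Rightarrow> ennreal"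
  assumes initial_state: "x0 \<in> S"
    and process: "markov_jump_process M S q x0 X T"
    and countable_states: "countable S"
    and rate_nonneg: "\<And>x z. x \<in> S \<Longrightarrow> z \<in> S \<Longrightarrow> 0 \<le> q x z"
    and finite_targets: "\<And>x. x \<in> S \<Longrightarrow> finite {z \<in> S. q x z \<noteq> 0}"
begin

sublocale prob_space M
  using process by (simp add: markov_jump_process_def)

lemma measurable_X: "X n \<in> measurable M (count_space S)"
  using process by (simp add: markov_jump_process_def)

lemma X_in_states: "\<omega> \<in> space M \<Longrightarrow> X n \<omega> \<in> S"
  using measurable_space[OF measurable_X] by simp

lemma measurable_T [measurable]: "T n \<in> borel_measurable M"
  using process by (simp add: markov_jump_process_def)

lemma measurable_of_X: "(\<lambda>\<omega>. f (X n \<omega>) :: 'b :: topological_space) \<in> borel_measurable M"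
  by (rule measurable_compose[OF measurable_X]) simp

lemma exit_rate_eq: "x \<in> S \<Longrightarrow> exit_rate S q x = (\<Sum>z | z \<in> S \<and> q x z \<noteq> 0. q x z)"
  unfolding exit_rate_def
  by (subst infsum_finite[symmetric, OF finite_targets]) (auto intro: infsum_cong_neutral)

lemma exit_rate_nonneg: "x \<in> S \<Longrightarrow> 0 \<le> exit_rate S q x"
  by (auto simp: exit_rate_eq rate_nonneg intro!: sum_nonneg)

lemma jump_prob_nonneg: "x \<in> S \<Longrightarrow> z \<in> S \<Longrightarrow> 0 \<le> jump_prob S q x z"
  by (simp add: jump_prob_def rate_nonneg exit_rate_nonneg)

lemma nn_integral_jump_prob:
  assumes "x \<in> S" "exit_rate S q x \<noteq> 0" "\<And>z. z \<in> S \<Longrightarrow> 0 \<le> f z"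
  shows "(\<integral>\<^sup>+z. ennreal (jump_prob S q x z * f z) \<partial>count_space S)
    = ennreal ((\<Sum>z | z \<in> S \<and> q x z \<noteq> 0. q x z * f z) / exit_rate S q x)"
proof -
  have "(\<integral>\<^sup>+z. ennreal (jump_prob S q x z * f z) \<partial>count_space S)
      = (\<Sum>z | z \<in> S \<and> q x z \<noteq> 0. ennreal (jump_prob S q x z * f z))"
    using assms finite_targets by (intro nn_integral_count_space') (auto simp: jump_prob_def)
  also have "\<dots> = ennreal (\<Sum>z | z \<in> S \<and> q x z \<noteq> 0. jump_prob S q x z * f z)"
    using assms by (intro sum_ennreal) (auto intro!: mult_nonneg_nonneg jump_prob_nonneg)
  also have "(\<Sum>z | z \<in> S \<and> q x z \<noteq> 0. jump_prob S q x z * f z)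
      = (\<Sum>z | z \<in> S \<and> q x z \<noteq> 0. q x z * f z) / exit_rate S q x"
    using assms by (simp add: jump_prob_def sum_divide_distrib)
  finally show ?thesis .
qed

lemma nn_integral_jump_prob_1:
  assumes "x \<in> S"
  shows "(\<integral>\<^sup>+z. ennreal (jump_prob S q x z) \<partial>count_space S) = 1"
proof (cases "exit_rate S q x = 0")
  case True
  have "(\<integral>\<^sup>+z. ennreal (jump_prob S q x z) \<partial>count_space S) = (\<Sum>z\<in>{x}. ennreal (jump_prob S q x z))"
    using assms True by (intro nn_integral_count_space') (auto simp: jump_prob_def)
  then show ?thesis
    using True by (simp add: jump_prob_def)
next
  case False
  then show ?thesis
    using nn_integral_jump_prob[OF assms False, of "\<lambda>_. 1"] assms by (simp add: exit_rate_eq)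
qed

text \<open>Only \<open>x 0\<close> to \<open>x n\<close> matter, so \<open>x(Suc j := z)\<close>
  extends a path ending at index \<open>j\<close> by the state \<open>z\<close>.\<close>

definition path_event :: "nat \<Rightarrow> (nat \<Rightarrow> 's) \<Rightarrow> 'w set" where
  "path_event n x = {\<omega> \<in> space M. \<forall>k\<le>n. X k \<omega> = x k}"

lemma sets_path_event [measurable]: "path_event n x \<in> sets M"
proof -
  have "Measurable.pred M (\<lambda>\<omega>. X k \<omega> = x k)" for k
    by (rule measurable_compose[OF measurable_X]) simp
  then show ?thesis
    unfolding path_event_def by measurable
qed

text \<open>For each outcome exactly one extension contributes, namely
  \<open>z = X (Suc j) \<omega>\<close>. Applied repeatedly along a path, this does the work of
  conditional expectations.\<close>

lemma nn_integral_next_state: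
  assumes [measurable]: "G \<in> borel_measurable M"
  shows "(\<integral>\<^sup>+\<omega>. G \<omega> * indicator (path_event j x) \<omega> \<partial>M)
    = (\<integral>\<^sup>+z. (\<integral>\<^sup>+\<omega>. G \<omega> * indicator (path_event (Suc j) (x(Suc j := z))) \<omega> \<partial>M) \<partial>count_space S)"
proof -
  have "(\<integral>\<^sup>+\<omega>. G \<omega> * indicator (path_event j x) \<omega> \<partial>M)
      = (\<integral>\<^sup>+\<omega>. (\<integral>\<^sup>+z. G \<omega> * indicator (path_event (Suc j) (x(Suc j := z))) \<omega> \<partial>count_space S) \<partial>M)"
  proof (intro nn_integral_cong)
    fix \<omega> assume \<omega>: "\<omega> \<in> space M"
    have "(\<integral>\<^sup>+z. G \<omega> * indicator (path_event (Suc j) (x(Suc j := z))) \<omega> \<partial>count_space S)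
        = (\<Sum>z\<in>{X (Suc j) \<omega>}. G \<omega> * indicator (path_event (Suc j) (x(Suc j := z))) \<omega>)"
      using X_in_states[OF \<omega>]
      by (intro nn_integral_count_space') (auto simp: path_event_def indicator_def le_Suc_eq)
    also have "\<dots> = G \<omega> * indicator (path_event j x) \<omega>"
      using \<omega> by (auto simp: path_event_def indicator_def le_Suc_eq)
    finally show "G \<omega> * indicator (path_event j x) \<omega>
        = (\<integral>\<^sup>+z. G \<omega> * indicator (path_event (Suc j) (x(Suc j := z))) \<omega> \<partial>count_space S)" ..
  qed
  also have "\<dots> = (\<integral>\<^sup>+z. (\<integral>\<^sup>+\<omega>. G \<omega> * indicator (path_event (Suc j) (x(Suc j := z))) \<omega> \<partial>M) \<partial>count_space S)"
    by (intro nn_integral_count_space_nn_integral countable_states) measurable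
  finally show ?thesis .
qed

lemma nn_integral_initial_state:
  assumes [measurable]: "G \<in> borel_measurable M"
  shows "(\<integral>\<^sup>+\<omega>. G \<omega> \<partial>M) = (\<integral>\<^sup>+z. (\<integral>\<^sup>+\<omega>. G \<omega> * indicator (path_event 0 (\<lambda>_. z)) \<omega> \<partial>M) \<partial>count_space S)"
proof -
  have "(\<integral>\<^sup>+\<omega>. G \<omega> \<partial>M) = (\<integral>\<^sup>+\<omega>. (\<integral>\<^sup>+z. G \<omega> * indicator (path_event 0 (\<lambda>_. z)) \<omega> \<partial>count_space S) \<partial>M)"
  proof (intro nn_integral_cong)
    fix \<omega> assume \<omega>: "\<omega> \<in> space M"
    have "(\<integral>\<^sup>+z. G \<omega> * indicator (path_event 0 (\<lambda>_. z)) \<omega> \<partial>count_space S)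
        = (\<Sum>z\<in>{X 0 \<omega>}. G \<omega> * indicator (path_event 0 (\<lambda>_. z)) \<omega>)"
      using X_in_states[OF \<omega>]
      by (intro nn_integral_count_space') (auto simp: path_event_def indicator_def)
    also have "\<dots> = G \<omega>"
      using \<omega> by (auto simp: path_event_def indicator_def)
    finally show "G \<omega> = (\<integral>\<^sup>+z. G \<omega> * indicator (path_event 0 (\<lambda>_. z)) \<omega> \<partial>count_space S)" ..
  qed
  also have "\<dots> = (\<integral>\<^sup>+z. (\<integral>\<^sup>+\<omega>. G \<omega> * indicator (path_event 0 (\<lambda>_. z)) \<omega> \<partial>M) \<partial>count_space S)"
    by (intro nn_integral_count_space_nn_integral countable_states) measurable
  finally show ?thesis .
qed

lemma nn_integral_cylinder:
  assumes "\<And>k. k \<le> n \<Longrightarrow> x k \<in> S" "\<And>k. 0 \<le> t k"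
  shows "(\<integral>\<^sup>+\<omega>. indicator (path_event n x) \<omega> * (\<Prod>k<n. indicator {ennreal (t k)<..} (T k \<omega>)) \<partial>M)
    = ennreal (of_bool (x 0 = x0) * (\<Prod>k<n. jump_prob S q (x k) (x (Suc k))) *
        (\<Prod>k<n. exp (- exit_rate S q (x k) * t k)))"
proof -
  let ?A = "{\<omega> \<in> space M. (\<forall>k\<le>n. X k \<omega> = x k) \<and> (\<forall>k<n. ennreal (t k) < T k \<omega>)}"
  have A: "?A = path_event n x \<inter> {\<omega> \<in> space M. \<forall>k<n. ennreal (t k) < T k \<omega>}"
    by (auto simp: path_event_def)
  have sets_A: "?A \<in> sets M"
    unfolding A by measurable
  have ind: "(\<Prod>k<m. indicator {ennreal (t k)<..} (T k \<omega>)) = (of_bool (\<forall>k<m. ennreal (t k) < T k \<omega>) :: ennreal)" for m \<omega>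
    by (induction m) (auto simp: less_Suc_eq indicator_def)
  have "(\<integral>\<^sup>+\<omega>. indicator (path_event n x) \<omega> * (\<Prod>k<n. indicator {ennreal (t k)<..} (T k \<omega>)) \<partial>M)
      = (\<integral>\<^sup>+\<omega>. indicator ?A \<omega> \<partial>M)"
    unfolding ind A by (intro nn_integral_cong) (simp add: indicator_def of_bool_conj)
  also have "\<dots> = ennreal (measure M ?A)"
    by (simp only: nn_integral_indicator[OF sets_A] emeasure_eq_measure)
  also have "measure M ?A = of_bool (x 0 = x0) *
      (\<Prod>k<n. jump_prob S q (x k) (x (Suc k)) * exp (- exit_rate S q (x k) * t k))"
    using process[unfolded markov_jump_process_def, THEN conjunct2, THEN conjunct2, THEN conjunct2] assms
    by (elim allE[of _ n] allE[of _ x] allE[of _ t]) simp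
  finally show ?thesis
    by (simp add: prod.distrib mult.assoc)
qed

lemma path_weight_nonneg:
  "(\<And>k. k \<le> n \<Longrightarrow> x k \<in> S) \<Longrightarrow> 0 \<le> (\<Prod>k<n. jump_prob S q (x k) (x (Suc k)))"
  by (intro prod_nonneg) (auto intro!: jump_prob_nonneg)

text \<open>The path event serves as the weight in \<open>nn_integral_prod_discount\<close>; on it
  each holding time contributes its Laplace transform at \<open>d\<close>, which is 0 for an
  absorbing state.\<close>

lemma nn_integral_cylinder_discount:
  assumes x: "\<And>k. k \<le> n \<Longrightarrow> x k \<in> S" and "0 < d"
  shows "(\<integral>\<^sup>+\<omega>. indicator (path_event n x) \<omega> * (\<Prod>k<n. discount d (T k \<omega>)) \<partial>M)
    = ennreal (of_bool (x 0 = x0) * (\<Prod>k<n. jump_prob S q (x k) (x (Suc k))) *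
        (\<Prod>k<n. exit_rate S q (x k) / (exit_rate S q (x k) + d)))"
proof (rule nn_integral_prod_discount)
  show "sigma_finite_measure M" ..
  show "0 \<le> of_bool (x 0 = x0) * (\<Prod>k<n. jump_prob S q (x k) (x (Suc k)))"
    using path_weight_nonneg[of n x] x by simp
qed (use assms nn_integral_cylinder[of n x] exit_rate_nonneg in auto)

text \<open>The law of the process speaks only of events \<open>t k < T k\<close>. With all
  \<open>t k = 0\<close> it gives such an event the full weight of its path, and the weights of all
  paths of a given length add up to 1, which leaves no mass for \<open>T k = 0\<close>.\<close>

lemma holding_times_positive: "AE \<omega> in M. \<forall>k. 0 < T k \<omega>"
proof -
  have "AE \<omega> in M. 0 < T m \<omega>" for m
  proof -
    define n where "n = Suc m"
    define G :: "'w \<Rightarrow> ennreal" where "G \<omega> = (\<Prod>k<n. indicator {0<..} (T k \<omega>))" for \<omega>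
    have [measurable]: "G \<in> borel_measurable M"
      unfolding G_def by measurable
    have path: "(\<integral>\<^sup>+\<omega>. G \<omega> * indicator (path_event j x) \<omega> \<partial>M)
        = ennreal (of_bool (x 0 = x0) * (\<Prod>k<j. jump_prob S q (x k) (x (Suc k))))"
      if "j \<le> n" "\<And>k. k \<le> j \<Longrightarrow> x k \<in> S" for j x
      using that
    \<comment> \<open>Downward induction from the full length \<open>n\<close>: the base case is the
      law with zero thresholds, and each step sums out the last state, whose transition
      probabilities add up to 1.\<close>
    proof (induction j arbitrary: x rule: inc_induct)
      case base
      then show ?case
        using nn_integral_cylinder[of n x "\<lambda>_. 0"] by (simp add: G_def mult.commute)
    next
      case (step j)
      let ?w = "of_bool (x 0 = x0) * (\<Prod>k<j. jump_prob S q (x k) (x (Suc k)))"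
      have w: "0 \<le> ?w"
        using path_weight_nonneg[of j x] step.prems by simp
      have "(\<integral>\<^sup>+\<omega>. G \<omega> * indicator (path_event j x) \<omega> \<partial>M)
          = (\<integral>\<^sup>+z. ennreal ?w * ennreal (jump_prob S q (x j) z) \<partial>count_space S)"
      proof (subst nn_integral_next_state, fact, intro nn_integral_cong)
        fix z assume "z \<in> space (count_space S)"
        then have "(\<integral>\<^sup>+\<omega>. G \<omega> * indicator (path_event (Suc j) (x(Suc j := z))) \<omega> \<partial>M)
            = ennreal (of_bool ((x(Suc j := z)) 0 = x0) *
                (\<Prod>k<Suc j. jump_prob S q ((x(Suc j := z)) k) ((x(Suc j := z)) (Suc k))))"
          using step.prems by (intro step.IH) auto
        also have "\<dots> = ennreal (?w * jump_prob S q (x j) z)"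
          by (simp add: mult.assoc)
        finally show "(\<integral>\<^sup>+\<omega>. G \<omega> * indicator (path_event (Suc j) (x(Suc j := z))) \<omega> \<partial>M)
            = ennreal ?w * ennreal (jump_prob S q (x j) z)"
          using w by (simp only: ennreal_mult')
      qed
      also have "\<dots> = ennreal ?w"
        using step.prems by (simp only: nn_integral_cmult borel_measurable_count_space nn_integral_jump_prob_1 mult_1_right order_refl)
      finally show ?case .
    qed
    have "(\<integral>\<^sup>+\<omega>. G \<omega> \<partial>M) = (\<integral>\<^sup>+z. ennreal (of_bool (z = x0)) \<partial>count_space S)"
      unfolding nn_integral_initial_state[OF \<open>G \<in> borel_measurable M\<close>]
      by (intro nn_integral_cong) (simp add: path)
    also have "\<dots> = (\<Sum>z\<in>{x0}. ennreal (of_bool (z = x0)))"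
      using initial_state by (intro nn_integral_count_space') auto
    also have "(\<integral>\<^sup>+\<omega>. G \<omega> \<partial>M) = emeasure M {\<omega> \<in> space M. \<forall>k<n. 0 < T k \<omega>}"
    proof -
      have "G \<omega> = of_bool (\<forall>k<n. 0 < T k \<omega>)" for \<omega>
        unfolding G_def by (induction n) (auto simp: less_Suc_eq indicator_def)
      then have "(\<integral>\<^sup>+\<omega>. G \<omega> \<partial>M) = (\<integral>\<^sup>+\<omega>. indicator {\<omega> \<in> space M. \<forall>k<n. 0 < T k \<omega>} \<omega> \<partial>M)"
        by (intro nn_integral_cong) (simp add: indicator_def)
      then show ?thesis
        by simp
    qed
    finally have "AE \<omega> in M. \<omega> \<in> {\<omega> \<in> space M. \<forall>k<n. 0 < T k \<omega>}"
      by (intro AE_prob_1) (simp add: emeasure_eq_measure)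
    then show ?thesis
      by eventually_elim (simp add: n_def)
  qed
  then show ?thesis
    by (simp add: AE_all_countable)
qed

text \<open>\<open>drift\<close> is the generator inequality: the sum of
  \<open>q x z * (W z - W x)\<close> is at most \<open>c * W x\<close>, with the exit rate moved to
  the right-hand side.\<close>

lemma foster_lyapunov_nonexplosion:
  fixes W :: "'s \<Rightarrow> real"
  assumes "0 < c" and W: "\<And>x. x \<in> S \<Longrightarrow> 1 \<le> W x"
    and drift: "\<And>x. x \<in> S \<Longrightarrow> (\<Sum>z | z \<in> S \<and> q x z \<noteq> 0. q x z * W z) \<le> (exit_rate S q x + c) * W x"
    and bounded: "\<And>w. \<exists>Q. \<forall>x\<in>S. W x \<le> w \<longrightarrow> exit_rate S q x \<le> Q"
  shows "AE \<omega> in M. (\<Sum>k. T k \<omega>) = \<infinity>"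
proof -
  define d where "d = c + 1"
  have "c < d" "0 < d"
    using \<open>0 < c\<close> by (auto simp: d_def)
  \<comment> \<open>With E the exit rate, \<open>r\<close> is the Laplace transform at
    \<open>d\<close> of the holding time, and \<open>h\<close> trades its denominator E + d for E +
    c. Thus \<open>h x * r x\<close> is E / (E + c), exactly what \<open>drift\<close>
    compensates.\<close>
  define h where "h x = (exit_rate S q x + d) / (exit_rate S q x + c)" for x
  define r where "r x = exit_rate S q x / (exit_rate S q x + d)" for x
  have h_nonneg: "0 \<le> h x" and r_nonneg: "0 \<le> r x" if "x \<in> S" for x
    using exit_rate_nonneg[OF that] \<open>0 < c\<close> by (auto simp: h_def r_def d_def)
  have one_step: "ennreal (h x * r x) * (\<integral>\<^sup>+z. ennreal (jump_prob S q x z * W z) \<partial>count_space S) \<le> ennreal (W x)"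
    if "x \<in> S" for x
  proof (cases "exit_rate S q x = 0")
    case False
    let ?E = "exit_rate S q x"
    have E: "0 < ?E"
      using exit_rate_nonneg[OF that] False by simp
    have "h x * r x = ?E / (?E + c)"
      using E \<open>0 < d\<close> by (simp add: h_def r_def)
    then have "h x * r x * ((\<Sum>z | z \<in> S \<and> q x z \<noteq> 0. q x z * W z) / ?E)
        = (\<Sum>z | z \<in> S \<and> q x z \<noteq> 0. q x z * W z) / (?E + c)"
      using E by simp
    also have "\<dots> \<le> W x"
      using drift[OF that] E \<open>0 < c\<close> by (simp add: field_simps)
    finally have "ennreal (h x * r x * ((\<Sum>z | z \<in> S \<and> q x z \<noteq> 0. q x z * W z) / ?E)) \<le> ennreal (W x)"
      by (rule ennreal_leI)
    moreover have "0 \<le> W z" if "z \<in> S" for z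
      using W[OF that] by simp
    ultimately show ?thesis
      using h_nonneg[OF that] r_nonneg[OF that]
      by (simp only: nn_integral_jump_prob[OF that False] ennreal_mult' mult_nonneg_nonneg)
  qed (simp add: r_def)
  define D :: "nat \<Rightarrow> 'w \<Rightarrow> ennreal" where
    "D n \<omega> = (\<Prod>k<n. ennreal (h (X k \<omega>)) * discount d (T k \<omega>)) * ennreal (W (X n \<omega>))" for n \<omega>
  note [measurable] = measurable_of_X
  have meas_D [measurable]: "D n \<in> borel_measurable M" for n
    unfolding D_def by measurable
  \<comment> \<open>The supermartingale inequality, integrated over a path prefix: the remaining
    steps from \<open>j\<close> to \<open>n\<close> cost nothing beyond the current value
    \<open>W (x j)\<close>. Downward induction sums out one state at a time by
    \<open>one_step\<close>.\<close>
  have path: "(\<integral>\<^sup>+\<omega>. D n \<omega> * indicator (path_event j x) \<omega> \<partial>M)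
      \<le> ennreal (of_bool (x 0 = x0) * (\<Prod>k<j. jump_prob S q (x k) (x (Suc k))) * (\<Prod>k<j. h (x k) * r (x k)) * W (x j))"
    if "j \<le> n" "\<And>k. k \<le> j \<Longrightarrow> x k \<in> S" for n j x
    using that
  proof (induction j arbitrary: x rule: inc_induct)
    case base
    have "(\<integral>\<^sup>+\<omega>. D n \<omega> * indicator (path_event n x) \<omega> \<partial>M)
        = (\<integral>\<^sup>+\<omega>. ennreal ((\<Prod>k<n. h (x k)) * W (x n)) *
            (indicator (path_event n x) \<omega> * (\<Prod>k<n. discount d (T k \<omega>))) \<partial>M)"
    proof (intro nn_integral_cong)
      fix \<omega> assume "\<omega> \<in> space M"
      have "(\<Prod>k<n. ennreal (h (x k))) = ennreal (\<Prod>k<n. h (x k))"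
        using base by (intro prod_ennreal h_nonneg) simp
      then show "D n \<omega> * indicator (path_event n x) \<omega> = ennreal ((\<Prod>k<n. h (x k)) * W (x n)) *
            (indicator (path_event n x) \<omega> * (\<Prod>k<n. discount d (T k \<omega>)))"
        using base h_nonneg W[of "x n"]
        by (auto simp: D_def path_event_def indicator_def prod.distrib ennreal_mult' prod_nonneg mult_ac)
    qed
    also have "\<dots> = ennreal ((\<Prod>k<n. h (x k)) * W (x n)) *
        ennreal (of_bool (x 0 = x0) * (\<Prod>k<n. jump_prob S q (x k) (x (Suc k))) * (\<Prod>k<n. r (x k)))"
      using base \<open>0 < d\<close> by (subst nn_integral_cmult) (simp_all add: nn_integral_cylinder_discount r_def)
    also have "\<dots> = ennreal (of_bool (x 0 = x0) * (\<Prod>k<n. jump_prob S q (x k) (x (Suc k))) * (\<Prod>k<n. h (x k) * r (x k)) * W (x n))"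
      using base h_nonneg W[of "x n"]
      by (subst ennreal_mult'[symmetric]) (auto simp: prod.distrib mult_ac intro!: mult_nonneg_nonneg prod_nonneg)
    finally show ?case
      by simp
  next
    case (step j)
    let ?w = "of_bool (x 0 = x0) * (\<Prod>k<j. jump_prob S q (x k) (x (Suc k))) * (\<Prod>k<j. h (x k) * r (x k))"
    have w: "0 \<le> ?w"
      using path_weight_nonneg[of j x] step.prems h_nonneg r_nonneg
      by (auto intro!: mult_nonneg_nonneg prod_nonneg)
    have hr: "0 \<le> h (x j) * r (x j)"
      using step.prems h_nonneg r_nonneg by simp
    have "(\<integral>\<^sup>+\<omega>. D n \<omega> * indicator (path_event j x) \<omega> \<partial>M)
        \<le> (\<integral>\<^sup>+z. ennreal ?w * (ennreal (h (x j) * r (x j)) * ennreal (jump_prob S q (x j) z * W z)) \<partial>count_space S)"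
    proof (subst nn_integral_next_state, rule meas_D, intro nn_integral_mono)
      fix z assume "z \<in> space (count_space S)"
      then have "(\<integral>\<^sup>+\<omega>. D n \<omega> * indicator (path_event (Suc j) (x(Suc j := z))) \<omega> \<partial>M)
          \<le> ennreal (of_bool ((x(Suc j := z)) 0 = x0) *
              (\<Prod>k<Suc j. jump_prob S q ((x(Suc j := z)) k) ((x(Suc j := z)) (Suc k))) *
              (\<Prod>k<Suc j. h ((x(Suc j := z)) k) * r ((x(Suc j := z)) k)) * W ((x(Suc j := z)) (Suc j)))"
        using step.prems by (intro step.IH) auto
      also have "\<dots> = ennreal (?w * (h (x j) * r (x j) * (jump_prob S q (x j) z * W z)))"
        by (simp add: mult_ac)
      finally show "(\<integral>\<^sup>+\<omega>. D n \<omega> * indicator (path_event (Suc j) (x(Suc j := z))) \<omega> \<partial>M)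
          \<le> ennreal ?w * (ennreal (h (x j) * r (x j)) * ennreal (jump_prob S q (x j) z * W z))"
        using w hr by (simp only: ennreal_mult')
    qed
    also have "\<dots> = ennreal ?w * (ennreal (h (x j) * r (x j)) * (\<integral>\<^sup>+z. ennreal (jump_prob S q (x j) z * W z) \<partial>count_space S))"
      by (simp only: nn_integral_cmult borel_measurable_count_space)
    also have "\<dots> \<le> ennreal ?w * ennreal (W (x j))"
      using step.prems by (intro mult_left_mono one_step) auto
    also have "\<dots> = ennreal (?w * W (x j))"
      using w by (simp only: ennreal_mult')
    finally show ?case .
  qed
  \<comment> \<open>At \<open>j = 0\<close> the products are empty, and only the initial state
    \<open>x0\<close> carries weight.\<close>
  have "(\<integral>\<^sup>+\<omega>. D n \<omega> \<partial>M) \<le> ennreal (W x0)" for n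
  proof -
    have "(\<integral>\<^sup>+\<omega>. D n \<omega> \<partial>M) \<le> (\<integral>\<^sup>+z. ennreal (of_bool (z = x0) * W z) \<partial>count_space S)"
      unfolding nn_integral_initial_state[OF meas_D]
      by (intro nn_integral_mono order_trans[OF path]) auto
    also have "\<dots> = (\<Sum>z\<in>{x0}. ennreal (of_bool (z = x0) * W z))"
      using initial_state by (intro nn_integral_count_space') auto
    finally show ?thesis
      by simp
  qed
  then have "liminf (\<lambda>n. \<integral>\<^sup>+\<omega>. D n \<omega> \<partial>M) \<le> ennreal (W x0)"
    by (intro Liminf_le) auto
  then have "(\<integral>\<^sup>+\<omega>. liminf (\<lambda>n. D n \<omega>) \<partial>M) \<le> ennreal (W x0)"
    using nn_integral_liminf[of D M] by (auto intro: order_trans)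
  then have "AE \<omega> in M. liminf (\<lambda>n. D n \<omega>) \<noteq> \<infinity>"
    by (intro nn_integral_noteq_infinite) (auto simp: top_unique)
  then show ?thesis
    using holding_times_positive AE_space
  proof eventually_elim
    case (elim \<omega>)
    show ?case
    proof (rule infinite_holding_time_sum)
      show "liminf (\<lambda>n. (\<Prod>k<n. ennreal ((exit_rate S q (X k \<omega>) + d) / (exit_rate S q (X k \<omega>) + c)) * discount d (T k \<omega>))
          * ennreal (W (X n \<omega>))) < \<infinity>"
        using elim(1) by (simp add: D_def h_def top.not_eq_extremum)
      show "\<exists>Q. \<forall>n. W (X n \<omega>) \<le> w \<longrightarrow> exit_rate S q (X n \<omega>) \<le> Q" for w
        using bounded[of w] X_in_states[OF elim(3)] by blast
    qed (use elim \<open>0 < c\<close> \<open>c < d\<close> W exit_rate_nonneg X_in_states in auto)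
  qed
qed

end

section \<open>From an infinite sum of holding times to the sample path\<close>

lemma jump_time_tendsto_infinity:
  "(\<Sum>k. T k \<omega>) = \<infinity> \<Longrightarrow> (\<lambda>n. jump_time T n \<omega>) \<longlonglongrightarrow> \<infinity>"
  using summable_LIMSEQ[of "\<lambda>k. T k \<omega>"] by (simp add: jump_time_def summableI)

lemma finitely_many_jumps:
  assumes "(\<Sum>k. T k \<omega>) = \<infinity>"
  shows "finite {n. 0 < n \<and> jump_time T n \<omega> \<le> ennreal t}"
proof -
  have "eventually (\<lambda>n. ennreal t < jump_time T n \<omega>) sequentially"
    using jump_time_tendsto_infinity[of T \<omega>] assms by (intro order_tendstoD(1)) auto
  then have "finite {n. \<not> ennreal t < jump_time T n \<omega>}"
    by (simp add: cofinite_eq_sequentially[symmetric] eventually_cofinite)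
  then show ?thesis
    by (rule rev_finite_subset) auto
qed

text \<open>The least \<open>n\<close> whose jump time exceeds \<open>t\<close> is not 0, because
  \<open>jump_time T 0\<close> is 0; its predecessor indexes the state occupied at time
  \<open>t\<close>.\<close>

lemma jump_path_eq_Some:
  assumes "(\<Sum>k. T k \<omega>) = \<infinity>"
  shows "\<exists>n. jump_path X T t \<omega> = Some (X n \<omega>)"
proof -
  have "eventually (\<lambda>n. ennreal t < jump_time T n \<omega>) sequentially"
    using jump_time_tendsto_infinity[of T \<omega>] assms by (intro order_tendstoD(1)) auto
  then obtain n where "ennreal t < jump_time T n \<omega>" "\<And>m. m < n \<Longrightarrow> \<not> ennreal t < jump_time T m \<omega>"
    using exists_least_iff[of "\<lambda>n. ennreal t < jump_time T n \<omega>"] by (auto simp: eventually_sequentially)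
  moreover from this(1) have "n \<noteq> 0"
    by (intro notI) (simp add: jump_time_def)
  ultimately have "\<exists>n. jump_time T n \<omega> \<le> ennreal t \<and> ennreal t < jump_time T (Suc n) \<omega>"
    by (metis lessI not_less old.nat.exhaust)
  then show ?thesis
    unfolding jump_path_def by auto
qed

section \<open>The double branching annihilating random walk\<close>

lemma configsD:
  assumes "y \<in> configs"
  shows "finite {i. y i \<noteq> 0}" "y i \<noteq> 0 \<Longrightarrow> \<bar>y i\<bar> = 1" "y i \<noteq> 0 \<Longrightarrow> y i = 1 \<or> y i = -1" "0 < particles y"
proof -
  have "y i \<in> {-1, 0, 1}"
    using assms unfolding configs_def by blast
  then show "y i \<noteq> 0 \<Longrightarrow> \<bar>y i\<bar> = 1" "y i \<noteq> 0 \<Longrightarrow> y i = 1 \<or> y i = -1"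
    by auto
qed (use assms in \<open>auto simp: configs_def intro: odd_pos\<close>)

text \<open>A configuration is determined by the finite sets of its positive and its negative
  particles.\<close>

lemma countable_configs: "countable configs"
proof (rule countable_image_inj_on)
  let ?f = "\<lambda>y :: int \<Rightarrow> int. ({i. y i = 1}, {i. y i = -1})"
  have "?f ` configs \<subseteq> Collect finite \<times> Collect finite"
    by (auto dest!: configsD(1) elim!: rev_finite_subset)
  then show "countable (?f ` configs)"
    by (rule countable_subset) (intro countable_SIGMA countable_Collect_finite)
  show "inj_on ?f configs"
  proof (intro inj_onI ext)
    fix y z i
    assume "y \<in> configs" "z \<in> configs" "?f y = ?f z"
    moreover from this have "y i = 1 \<longleftrightarrow> z i = 1" "y i = -1 \<longleftrightarrow> z i = -1"
      by (auto simp: set_eq_iff)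
    ultimately show "y i = z i"
      by (metis configsD(3))
  qed
qed

lemma card_support_configs:
  assumes "y \<in> configs"
  shows "card {i. y i \<noteq> 0} = particles y"
proof -
  have "particles y = (\<Sum>i | y i \<noteq> 0. 1)"
    unfolding particles_def by (intro sum.cong) (use configsD(2)[OF assms] in auto)
  then show ?thesis
    by simp
qed

text \<open>Both counts are written as sums over one finite set containing both supports. The
  increment \<open>e\<close> may be negative, which records a vacated site.\<close>

lemma particles_le:
  assumes "finite A" "\<And>k. k \<notin> A \<Longrightarrow> y k = 0" "\<And>k. k \<notin> A \<Longrightarrow> z k = 0"
    and "\<And>k. \<bar>z k\<bar> \<le> \<bar>y k\<bar> + e k"
  shows "int (particles z) \<le> int (particles y) + (\<Sum>k\<in>A. e k)"
proof -
  have *: "int (particles u) = (\<Sum>k\<in>A. \<bar>u k\<bar>)" if "\<And>k. k \<notin> A \<Longrightarrow> u k = 0" for u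
  proof -
    have "particles u = (\<Sum>k\<in>A. nat \<bar>u k\<bar>)"
      unfolding particles_def using that \<open>finite A\<close> by (intro sum.mono_neutral_left) auto
    then show ?thesis
      by simp
  qed
  show ?thesis
    using assms(2,3) sum_mono[of A, OF assms(4)] by (simp add: * sum.distrib)
qed

text \<open>The factor \<open>y i\<close> treats both signs at once; annihilation with an opposite
  particle at \<open>j\<close> happens by addition.\<close>

definition hop :: "(int \<Rightarrow> int) \<Rightarrow> int \<Rightarrow> int \<Rightarrow> int \<Rightarrow> int" where
  "hop y i j = (\<lambda>k. y k - y i * unit_at i k + y i * unit_at j k)"

text \<open>Site \<open>i\<close> ends up with the value \<open>- y i\<close>: the parent changes
  sign, and the two neighbours receive offspring of its old sign.\<close>

definition branch :: "(int \<Rightarrow> int) \<Rightarrow> int \<Rightarrow> int \<Rightarrow> int" where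
  "branch y i = (\<lambda>k. y k + y i * unit_at (i - 1) k - 2 * y i * unit_at i k + y i * unit_at (i + 1) k)"

text \<open>By the triangle inequality site \<open>j\<close> gains at most 1, which is balanced by
  the loss of 1 at site \<open>i\<close>.\<close>

lemma particles_hop:
  assumes "y \<in> configs" "y i \<noteq> 0" "i \<noteq> j"
  shows "particles (hop y i j) \<le> particles y"
proof -
  let ?A = "insert i (insert j {i. y i \<noteq> 0})"
  have "finite ?A"
    using configsD(1)[OF assms(1)] by simp
  then have "int (particles (hop y i j)) \<le> int (particles y) + (\<Sum>k\<in>?A. unit_at j k - unit_at i k)"
    by (rule particles_le) (use configsD(2)[OF assms(1,2)] \<open>i \<noteq> j\<close> in \<open>auto simp: hop_def unit_at_def\<close>)
  also have "(\<Sum>k\<in>?A. unit_at j k - unit_at i k) = 0"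
    using \<open>finite ?A\<close> by (simp add: sum_subtractf unit_at_def of_bool_def sum.delta del: sum.insert)
  finally show ?thesis
    by simp
qed

lemma particles_branch:
  assumes "y \<in> configs" "y i \<noteq> 0"
  shows "particles (branch y i) \<le> particles y + 2"
proof -
  let ?A = "insert (i - 1) (insert i (insert (i + 1) {i. y i \<noteq> 0}))"
  have "finite ?A"
    using configsD(1)[OF assms(1)] by simp
  then have "int (particles (branch y i)) \<le> int (particles y) + (\<Sum>k\<in>?A. unit_at (i - 1) k + unit_at (i + 1) k)"
    by (rule particles_le) (use configsD(2)[OF assms] in \<open>auto simp: branch_def unit_at_def\<close>)
  also have "(\<Sum>k\<in>?A. unit_at (i - 1) k + unit_at (i + 1) k) = 2"
    using \<open>finite ?A\<close> by (simp add: sum.distrib unit_at_def of_bool_def sum.delta del: sum.insert)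
  finally show ?thesis
    by simp
qed

section \<open>Growth of the branching bound and divergence of the regularised series\<close>

lemma max_branching_ge: "1 \<le> n \<Longrightarrow> n \<le> N \<Longrightarrow> real n * B n \<le> max_branching B N"
  unfolding max_branching_def by (intro Max_ge) auto

lemma max_branching_mono: "1 \<le> n \<Longrightarrow> n \<le> N \<Longrightarrow> max_branching B n \<le> max_branching B N"
  unfolding max_branching_def by (intro Max_mono) auto

lemma suminf_ennreal_unbounded:
  fixes a :: "nat \<Rightarrow> real" and b :: "nat \<Rightarrow> ennreal"
  assumes "(\<Sum>n. b n) = \<infinity>" "0 < c" "\<And>n. 0 \<le> a n" "\<And>n. ennreal c * b n \<le> ennreal (a n)"
  shows "\<exists>n. w < (\<Sum>k<n. a k)"
proof (rule ccontr)
  assume "\<not> (\<exists>n. w < (\<Sum>k<n. a k))"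
  then have "(\<Sum>k<n. ennreal (a k)) \<le> ennreal w" for n
    using assms(3) by (simp add: sum_ennreal ennreal_leI not_less)
  then have "(\<Sum>n. ennreal (a n)) \<le> ennreal w"
    by (intro suminf_le_const summableI)
  moreover have "(\<Sum>n. ennreal c * b n) \<le> (\<Sum>n. ennreal (a n))"
    by (intro suminf_le summableI assms(4))
  moreover have "(\<Sum>n. ennreal c * b n) = \<infinity>"
    using assms(1,2) by (simp add: ennreal_mult_top)
  ultimately show False
    by (simp add: top_unique)
qed

text \<open>If \<open>B 1 = 0\<close>, the first term of \<open>divergence\<close> is 1/0 = infinity
  and the assumption holds without restricting growth; then \<open>divergence_degenerate\<close>
  supplies divergence of the tails. If \<open>B 1 > 0\<close>, all terms are finite. In both cases
  the series diverges from an index where the maximum is positive, and there adding 1 to the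
  denominator changes terms only by a bounded factor. If the maximum is always 0, every regularised
  term is 1.\<close>

lemma max_branching_sum_unbounded:
  assumes B_nonneg: "\<And>n. 1 \<le> n \<Longrightarrow> 0 \<le> B n"
    and divergence: "(\<Sum>N. 1 / ennreal (max_branching B (Suc N))) = \<infinity>"
    and divergence_degenerate: "B 1 = 0 \<Longrightarrow> \<forall>K. (\<Sum>N. 1 / ennreal (max_branching B (Suc (N + K)))) = \<infinity>"
  shows "\<exists>n. w < (\<Sum>m<n. 1 / (1 + max_branching B (Suc m)))"
proof -
  have nonneg: "0 \<le> max_branching B (Suc m)" for m
    using max_branching_ge[of 1 "Suc m" B] B_nonneg[of 1] by simp
  show ?thesis
  proof (cases "\<exists>K. 0 < max_branching B (Suc K)")
    case False
    then have "max_branching B (Suc m) = 0" for m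
      using nonneg by (meson antisym not_le)
    then show ?thesis
      using reals_Archimedean2 by simp
  next
    case True
    have "\<exists>K. 0 < max_branching B (Suc K) \<and> (\<Sum>N. 1 / ennreal (max_branching B (Suc (N + K)))) = \<infinity>"
    proof (cases "B 1 = 0")
      case True
      then show ?thesis
        using divergence_degenerate \<open>\<exists>K. 0 < max_branching B (Suc K)\<close> by blast
    next
      case False
      then have "0 < max_branching B (Suc 0)"
        using B_nonneg[of 1] by (simp add: max_branching_def)
      then show ?thesis
        using divergence by (intro exI[of _ 0]) simp
    qed
    then obtain K where K: "0 < max_branching B (Suc K)"
      "(\<Sum>N. 1 / ennreal (max_branching B (Suc (N + K)))) = \<infinity>"
      by blast
    define b where "b = max_branching B (Suc K)"
    have "\<exists>n. w < (\<Sum>m<n. 1 / (1 + max_branching B (Suc (m + K))))"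
    \<comment> \<open>The constant comes from
      \<open>b / (1 + b) * (1 / x) \<le> 1 / (1 + x)\<close>, valid for
      \<open>x \<ge> b > 0\<close>; by monotonicity all maxima from index \<open>Suc K\<close> on
      are at least \<open>b\<close>.\<close>
    proof (rule suminf_ennreal_unbounded[OF K(2)])
      show "0 < b / (1 + b)"
        using K(1) by (simp add: b_def)
      fix m
      have "0 < b"
        using K(1) by (simp add: b_def)
      have "b \<le> max_branching B (Suc (m + K))"
        unfolding b_def by (intro max_branching_mono) auto
      with \<open>0 < b\<close> have "b / (1 + b) * (1 / max_branching B (Suc (m + K))) \<le> 1 / (1 + max_branching B (Suc (m + K)))"
        by (simp add: divide_simps add_pos_pos) (simp add: algebra_simps)
      then show "ennreal (b / (1 + b)) * (1 / ennreal (max_branching B (Suc (m + K))))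
          \<le> ennreal (1 / (1 + max_branching B (Suc (m + K))))"
        using divide_ennreal[of 1 "max_branching B (Suc (m + K))"] \<open>0 < b\<close> \<open>b \<le> _\<close>
        by (simp add: ennreal_mult'[symmetric] ennreal_leI)
    qed (simp add: nonneg)
    then obtain n where "w < (\<Sum>m<n. 1 / (1 + max_branching B (Suc (m + K))))" ..
    also have "\<dots> = (\<Sum>m\<in>{K..<n + K}. 1 / (1 + max_branching B (Suc m)))"
      using sum.shift_bounds_nat_ivl[of "\<lambda>m. 1 / (1 + max_branching B (Suc m))" 0 K n]
      by (simp add: atLeast0LessThan)
    also have "\<dots> \<le> (\<Sum>m<n + K. 1 / (1 + max_branching B (Suc m)))"
      by (intro sum_mono2) (auto simp: nonneg)
    finally show ?thesis ..
  qed
qed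

section \<open>Transition rates of the walk\<close>

text \<open>At a particle of one sign the rates for the other sign vanish, so adding both merges the
  two sums into one over all particles.\<close>

lemma dbarw_rate_eq:
  assumes y: "y \<in> configs"
    and pos: "\<And>i. y i \<noteq> 1 \<Longrightarrow> rp i y = 0 \<and> lp i y = 0 \<and> bp i y = 0"
    and neg: "\<And>i. y i \<noteq> -1 \<Longrightarrow> rm i y = 0 \<and> lm i y = 0 \<and> bm i y = 0"
  shows "dbarw_rate \<alpha>1 \<alpha>2 rp lp bp rm lm bm y z =
    (\<Sum>i | y i \<noteq> 0. \<alpha>1 * (rp i y + rm i y) * of_bool (z = hop y i (i + 1))
      + \<alpha>1 * (lp i y + lm i y) * of_bool (z = hop y i (i - 1))
      + \<alpha>2 * (bp i y + bm i y) * of_bool (z = branch y i))"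
    (is "_ = (\<Sum>i | y i \<noteq> 0. ?F i)")
proof -
  have split: "{i. y i \<noteq> 0} = {i. y i = 1} \<union> {i. y i = -1}"
    using configsD(3)[OF y] by auto
  have fin: "finite {i. y i = 1}" "finite {i. y i = -1}"
    using configsD(1)[OF y] by (auto elim!: rev_finite_subset)
  have "(\<Sum>i | y i \<noteq> 0. ?F i) = (\<Sum>i | y i = 1. ?F i) + (\<Sum>i | y i = -1. ?F i)"
    unfolding split using fin by (intro sum.union_disjoint) auto
  moreover have "(\<Sum>i | y i = 1. ?F i) = (\<Sum>i | y i = 1.
         \<alpha>1 * rp i y * of_bool (z = (\<lambda>j. y j - unit_at i j + unit_at (i + 1) j))
       + \<alpha>1 * lp i y * of_bool (z = (\<lambda>j. y j + unit_at (i - 1) j - unit_at i j))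
       + \<alpha>2 * bp i y * of_bool (z = (\<lambda>j. y j + unit_at (i - 1) j - 2 * unit_at i j + unit_at (i + 1) j)))"
    by (intro sum.cong) (auto simp: neg hop_def branch_def algebra_simps)
  moreover have "(\<Sum>i | y i = -1. ?F i) = (\<Sum>i | y i = -1.
         \<alpha>1 * rm i y * of_bool (z = (\<lambda>j. y j + unit_at i j - unit_at (i + 1) j))
       + \<alpha>1 * lm i y * of_bool (z = (\<lambda>j. y j - unit_at (i - 1) j + unit_at i j))
       + \<alpha>2 * bm i y * of_bool (z = (\<lambda>j. y j - unit_at (i - 1) j + 2 * unit_at i j - unit_at (i + 1) j)))"
    by (intro sum.cong) (auto simp: pos hop_def branch_def algebra_simps)
  ultimately show ?thesis
    unfolding dbarw_rate_def by simp
qed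

locale dbarw_rates =
  fixes \<alpha>1 \<alpha>2 :: real
    and rp lp bp rm lm bm :: "int \<Rightarrow> (int \<Rightarrow> int) \<Rightarrow> real"
    and B :: "nat \<Rightarrow> real"
  assumes \<alpha>1: "0 \<le> \<alpha>1" and \<alpha>2: "0 \<le> \<alpha>2"
    and rates_nonneg: "\<And>i y. y \<in> configs \<Longrightarrow>
      0 \<le> rp i y \<and> 0 \<le> lp i y \<and> 0 \<le> bp i y \<and> 0 \<le> rm i y \<and> 0 \<le> lm i y \<and> 0 \<le> bm i y"
    and rates_pos: "\<And>i y. y \<in> configs \<Longrightarrow> y i \<noteq> 1 \<Longrightarrow> rp i y = 0 \<and> lp i y = 0 \<and> bp i y = 0"
    and rates_neg: "\<And>i y. y \<in> configs \<Longrightarrow> y i \<noteq> -1 \<Longrightarrow> rm i y = 0 \<and> lm i y = 0 \<and> bm i y = 0"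
    and jump_bound: "\<And>i y. y \<in> configs \<Longrightarrow> y i \<noteq> 0 \<Longrightarrow> rp i y + lp i y + rm i y + lm i y \<le> 1"
    and branch_bound: "\<And>n i y. 1 \<le> n \<Longrightarrow> y \<in> configs \<Longrightarrow> particles y = n \<Longrightarrow> bp i y + bm i y \<le> B n"
begin

abbreviation rate :: "(int \<Rightarrow> int) \<Rightarrow> (int \<Rightarrow> int) \<Rightarrow> real" where
  "rate \<equiv> dbarw_rate \<alpha>1 \<alpha>2 rp lp bp rm lm bm"

lemma rate_eq:
  "y \<in> configs \<Longrightarrow> rate y z = (\<Sum>i | y i \<noteq> 0. \<alpha>1 * (rp i y + rm i y) * of_bool (z = hop y i (i + 1))
      + \<alpha>1 * (lp i y + lm i y) * of_bool (z = hop y i (i - 1))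
      + \<alpha>2 * (bp i y + bm i y) * of_bool (z = branch y i))"
  using rates_pos rates_neg by (intro dbarw_rate_eq)

lemma rate_nonneg: "y \<in> configs \<Longrightarrow> 0 \<le> rate y z"
  using \<alpha>1 \<alpha>2 rates_nonneg by (auto simp: rate_eq intro!: sum_nonneg add_nonneg_nonneg mult_nonneg_nonneg)

lemma finite_rate_targets:
  assumes y: "y \<in> configs"
  shows "finite {z \<in> configs. rate y z \<noteq> 0}"
proof (rule finite_subset)
  show "{z \<in> configs. rate y z \<noteq> 0} \<subseteq> (\<Union>i\<in>{i. y i \<noteq> 0}. {hop y i (i + 1), hop y i (i - 1), branch y i})"
  proof safe
    fix z assume "rate y z \<noteq> 0"
    then obtain i where "y i \<noteq> 0" and
      "\<alpha>1 * (rp i y + rm i y) * of_bool (z = hop y i (i + 1))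
      + \<alpha>1 * (lp i y + lm i y) * of_bool (z = hop y i (i - 1))
      + \<alpha>2 * (bp i y + bm i y) * of_bool (z = branch y i) \<noteq> 0"
      unfolding rate_eq[OF y] by (auto elim!: sum.not_neutral_contains_not_neutral)
    then show "z \<in> (\<Union>i\<in>{i. y i \<noteq> 0}. {hop y i (i + 1), hop y i (i - 1), branch y i})"
      by (auto simp: of_bool_def split: if_splits)
  qed
  show "finite (\<Union>i\<in>{i. y i \<noteq> 0}. {hop y i (i + 1), hop y i (i - 1), branch y i})"
    using configsD(1)[OF y] by simp
qed

text \<open>One estimate for two purposes: increments of the Lyapunov function as \<open>g\<close>
  give the drift, and \<open>g = 1\<close> gives the exit rate. Each particle hops at total rate at
  most \<open>\<alpha>1\<close> and branches at rate at most
  \<open>\<alpha>2 * B (particles y)\<close>. Targets outside \<open>Z\<close> contribute 0, which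
  \<open>0 \<le> a\<close> and \<open>0 \<le> b\<close> cover.\<close>

lemma sum_rate_le:
  assumes y: "y \<in> configs" and "finite Z"
    and hop: "\<And>i j. y i \<noteq> 0 \<Longrightarrow> i \<noteq> j \<Longrightarrow> hop y i j \<in> Z \<Longrightarrow> g (hop y i j) \<le> a" and "0 \<le> a"
    and branch: "\<And>i. y i \<noteq> 0 \<Longrightarrow> branch y i \<in> Z \<Longrightarrow> g (branch y i) \<le> b" and "0 \<le> b"
  shows "(\<Sum>z\<in>Z. rate y z * g z) \<le> particles y * (\<alpha>1 * a + \<alpha>2 * B (particles y) * b)"
proof -
  have eq: "(\<Sum>z\<in>Z. of_bool (z = u) * g z) = (if u \<in> Z then g u else 0)" for u
    using \<open>finite Z\<close> by (simp add: of_bool_def if_distrib[of "\<lambda>c. c * _"] sum.delta cong: if_cong)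
  have "(\<Sum>z\<in>Z. rate y z * g z) = (\<Sum>i | y i \<noteq> 0. \<Sum>z\<in>Z.
        \<alpha>1 * (rp i y + rm i y) * (of_bool (z = hop y i (i + 1)) * g z)
      + \<alpha>1 * (lp i y + lm i y) * (of_bool (z = hop y i (i - 1)) * g z)
      + \<alpha>2 * (bp i y + bm i y) * (of_bool (z = branch y i) * g z))"
    by (subst sum.swap) (simp add: rate_eq[OF y] sum_distrib_right distrib_right mult.assoc)
  also have "\<dots> \<le> (\<Sum>i | y i \<noteq> 0. \<alpha>1 * a + \<alpha>2 * B (particles y) * b)"
  proof (rule sum_mono)
    fix i assume "i \<in> {i. y i \<noteq> 0}"
    then have i: "y i \<noteq> 0" by simp
    note nonneg = rates_nonneg[OF y, of i]
    have "(\<Sum>z\<in>Z. \<alpha>1 * (rp i y + rm i y) * (of_bool (z = hop y i (i + 1)) * g z)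
      + \<alpha>1 * (lp i y + lm i y) * (of_bool (z = hop y i (i - 1)) * g z)
      + \<alpha>2 * (bp i y + bm i y) * (of_bool (z = branch y i) * g z))
      = \<alpha>1 * (rp i y + rm i y) * (if hop y i (i + 1) \<in> Z then g (hop y i (i + 1)) else 0)
      + \<alpha>1 * (lp i y + lm i y) * (if hop y i (i - 1) \<in> Z then g (hop y i (i - 1)) else 0)
      + \<alpha>2 * (bp i y + bm i y) * (if branch y i \<in> Z then g (branch y i) else 0)"
      by (simp only: sum.distrib sum_distrib_left[symmetric] eq)
    also have "\<dots> \<le> \<alpha>1 * (rp i y + rm i y) * a + \<alpha>1 * (lp i y + lm i y) * a + \<alpha>2 * (bp i y + bm i y) * b"
      using nonneg \<alpha>1 \<alpha>2 i \<open>0 \<le> a\<close> \<open>0 \<le> b\<close>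
      by (intro add_mono mult_left_mono) (auto intro: hop branch)
    also have "\<dots> = \<alpha>1 * a * (rp i y + lp i y + rm i y + lm i y) + \<alpha>2 * b * (bp i y + bm i y)"
      by (simp add: algebra_simps)
    also have "\<dots> \<le> \<alpha>1 * a * 1 + \<alpha>2 * b * B (particles y)"
      using \<alpha>1 \<alpha>2 \<open>0 \<le> a\<close> \<open>0 \<le> b\<close> configsD(4)[OF y]
      by (intro add_mono mult_left_mono jump_bound branch_bound y i) auto
    finally show "(\<Sum>z\<in>Z. \<alpha>1 * (rp i y + rm i y) * (of_bool (z = hop y i (i + 1)) * g z)
      + \<alpha>1 * (lp i y + lm i y) * (of_bool (z = hop y i (i - 1)) * g z)
      + \<alpha>2 * (bp i y + bm i y) * (of_bool (z = branch y i) * g z)) \<le> \<alpha>1 * a + \<alpha>2 * B (particles y) * b"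
      by (simp add: mult_ac)
  qed
  also have "\<dots> = particles y * (\<alpha>1 * a + \<alpha>2 * B (particles y) * b)"
    using card_support_configs[OF y] by simp
  finally show ?thesis .
qed

end

text \<open>Both conclusions follow from one almost sure event, that the holding times have infinite
  sum, so the exceptional null set does not depend on \<open>t\<close>. The condition
  \<open>0 < n\<close> leaves out index 0, which is the start and not a jump.\<close>

theorem proposition1:
  fixes \<alpha>1 \<alpha>2 :: real
    and rp lp bp rm lm bm :: "int \<Rightarrow> (int \<Rightarrow> int) \<Rightarrow> real"
    and B :: "nat \<Rightarrow> real"
    and Y0 :: "int \<Rightarrow> int"
    and M :: "'w measure"
    and X :: "nat \<Rightarrow> 'w \<Rightarrow> (int \<Rightarrow> int)"
    and T :: "nat \<Rightarrow> 'w \<Rightarrow> ennreal"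
  assumes "0 \<le> \<alpha>1" and "0 \<le> \<alpha>2"
    and rates_nonneg: "\<And>i y. y \<in> configs \<Longrightarrow>
      0 \<le> rp i y \<and> 0 \<le> lp i y \<and> 0 \<le> bp i y \<and> 0 \<le> rm i y \<and> 0 \<le> lm i y \<and> 0 \<le> bm i y"
    and rates_pos: "\<And>i y. y \<in> configs \<Longrightarrow> y i \<noteq> 1 \<Longrightarrow> rp i y = 0 \<and> lp i y = 0 \<and> bp i y = 0"
    and rates_neg: "\<And>i y. y \<in> configs \<Longrightarrow> y i \<noteq> -1 \<Longrightarrow> rm i y = 0 \<and> lm i y = 0 \<and> bm i y = 0"
    and jump_bound: "\<And>i y. y \<in> configs \<Longrightarrow> y i \<noteq> 0 \<Longrightarrow> rp i y + lp i y + rm i y + lm i y \<le> 1"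
    and B_nonneg: "\<And>n. 1 \<le> n \<Longrightarrow> 0 \<le> B n"
    and branch_bound: "\<And>n i y. 1 \<le> n \<Longrightarrow> y \<in> configs \<Longrightarrow> particles y = n \<Longrightarrow> bp i y + bm i y \<le> B n"
    and divergence: "(\<Sum>N. 1 / ennreal (max_branching B (Suc N))) = \<infinity>"
    and divergence_degenerate: "B 1 = 0 \<Longrightarrow> \<forall>K. (\<Sum>N. 1 / ennreal (max_branching B (Suc (N + K)))) = \<infinity>"
    and Y0: "Y0 \<in> configs"
    and process: "markov_jump_process M configs (dbarw_rate \<alpha>1 \<alpha>2 rp lp bp rm lm bm) Y0 X T"
  shows "(AE \<omega> in M. \<forall>t\<ge>0. finite {n. 0 < n \<and> jump_time T n \<omega> \<le> ennreal t}) \<and>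
    (AE \<omega> in M. \<forall>t>0. \<exists>y\<in>configs. jump_path X T t \<omega> = Some y)"
proof -
  interpret R: dbarw_rates \<alpha>1 \<alpha>2 rp lp bp rm lm bm B
    by unfold_locales (fact assms)+
  interpret P: finite_range_jump_process M configs R.rate Y0 X T
    using Y0 process countable_configs R.rate_nonneg R.finite_rate_targets by unfold_locales
  define f where "f n = (\<Sum>m<n. 1 / (1 + max_branching B (Suc m)))" for n
  have max_nonneg: "0 \<le> max_branching B (Suc m)" for m
    using max_branching_ge[of 1 "Suc m" B] B_nonneg[of 1] by simp
  have f_mono: "f m \<le> f n" if "m \<le> n" for m n
    unfolding f_def using that max_nonneg by (intro sum_mono2) auto
  have f_nonneg: "0 \<le> f n" for n
    using max_nonneg by (auto simp: f_def intro!: sum_nonneg)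
  \<comment> \<open>With \<open>b = max_branching B n\<close>, the increment of \<open>f\<close>
    consists of two terms, for \<open>n + 1\<close> and \<open>n + 2\<close>, each at most
    \<open>1 / (1 + b)\<close> by monotonicity, while \<open>real n * B n\<close> is at most
    \<open>b\<close>. The added 1 keeps the denominators positive when \<open>b = 0\<close>.\<close>
  have f_step: "real n * B n * (f (n + 2) - f n) \<le> 2" if "1 \<le> n" for n
  proof -
    let ?b = "max_branching B n"
    have b: "0 \<le> ?b" "real n * B n \<le> ?b"
      using max_nonneg[of "n - 1"] that max_branching_ge[of n n] by auto
    have "f (n + 2) - f n = 1 / (1 + max_branching B (Suc n)) + 1 / (1 + max_branching B (Suc (Suc n)))"
      by (simp add: f_def)
    also have "\<dots> \<le> 1 / (1 + ?b) + 1 / (1 + ?b)"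
      using b that by (intro add_mono divide_left_mono add_left_mono max_branching_mono)
        (auto intro!: mult_pos_pos add_pos_nonneg max_nonneg)
    finally have "real n * B n * (f (n + 2) - f n) \<le> ?b * (2 / (1 + ?b))"
      using b f_mono[of n "n + 2"] by (intro mult_mono) auto
    also have "\<dots> \<le> 2"
      using b by (simp add: field_simps)
    finally show ?thesis .
  qed
  have "AE \<omega> in M. (\<Sum>k. T k \<omega>) = \<infinity>"
  proof (rule P.foster_lyapunov_nonexplosion)
    \<comment> \<open>The drift is at most \<open>2 * \<alpha>2\<close>; the extra 1 makes the
      constant positive also for \<open>\<alpha>2 = 0\<close>.\<close>
    show "0 < 2 * \<alpha>2 + 1"
      using \<open>0 \<le> \<alpha>2\<close> by simp
    show "1 \<le> 1 + f (particles y)" for y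
      using f_nonneg by simp
    fix y :: "int \<Rightarrow> int" assume y: "y \<in> configs"
    let ?Z = "{z. z \<in> configs \<and> R.rate y z \<noteq> 0}" and ?n = "particles y"
    \<comment> \<open>Hops get the bound 0 because they do not raise the particle number and
      \<open>f\<close> is monotone; only branching, which adds at most 2 particles, remains.\<close>
    have "(\<Sum>z\<in>?Z. R.rate y z * (f (particles z) - f ?n)) \<le> ?n * (\<alpha>1 * 0 + \<alpha>2 * B ?n * (f (?n + 2) - f ?n))"
      using y by (intro R.sum_rate_le R.finite_rate_targets)
        (use y particles_branch in \<open>auto intro!: f_mono particles_hop\<close>)
    also have "\<dots> = \<alpha>2 * (?n * B ?n * (f (?n + 2) - f ?n))"
      by simp
    also have "\<dots> \<le> \<alpha>2 * 2"
      using configsD(4)[OF y] \<open>0 \<le> \<alpha>2\<close> by (intro mult_left_mono f_step) auto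
    also have "\<dots> \<le> (2 * \<alpha>2 + 1) * (1 + f ?n)"
      using mult_mono[of "2 * \<alpha>2" "2 * \<alpha>2 + 1" 1 "1 + f ?n"] \<open>0 \<le> \<alpha>2\<close> f_nonneg[of ?n] by simp
    \<comment> \<open>Adding the exit rate times \<open>1 + f ?n\<close> to both sides turns the sum
      over increments into the form of the criterion.\<close>
    finally show "(\<Sum>z\<in>?Z. R.rate y z * (1 + f (particles z)))
        \<le> (exit_rate configs R.rate y + (2 * \<alpha>2 + 1)) * (1 + f ?n)"
      by (simp add: P.exit_rate_eq[OF y] algebra_simps sum.distrib sum_subtractf sum_distrib_left)
  next
    fix w :: real
    \<comment> \<open>The divergence assumptions enter here: since \<open>f\<close> is unbounded and
      monotone, a bound on the Lyapunov function bounds the particle number by \<open>N\<close>, and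
      with it the exit rate.\<close>
    obtain N where N: "w < f N"
      using max_branching_sum_unbounded[OF B_nonneg divergence divergence_degenerate, of w]
      unfolding f_def by blast
    show "\<exists>Q. \<forall>y\<in>configs. 1 + f (particles y) \<le> w \<longrightarrow> exit_rate configs R.rate y \<le> Q"
    proof (intro exI ballI impI)
      fix y assume y: "y \<in> configs" and le: "1 + f (particles y) \<le> w"
      let ?n = "particles y"
      have n: "1 \<le> ?n" "?n \<le> N"
        using configsD(4)[OF y] f_mono[of N ?n] N le by (cases "?n \<le> N"; simp)+
      have "exit_rate configs R.rate y = (\<Sum>z | z \<in> configs \<and> R.rate y z \<noteq> 0. R.rate y z * 1)"
        by (simp add: P.exit_rate_eq[OF y])
      also have "\<dots> \<le> ?n * (\<alpha>1 * 1 + \<alpha>2 * B ?n * 1)"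
        using y by (intro R.sum_rate_le R.finite_rate_targets) auto
      also have "\<dots> = \<alpha>1 * ?n + \<alpha>2 * (?n * B ?n)"
        by (simp add: algebra_simps)
      also have "\<dots> \<le> \<alpha>1 * N + \<alpha>2 * max_branching B N"
        using n assms(1,2) by (intro add_mono mult_left_mono max_branching_ge) auto
      finally show "exit_rate configs R.rate y \<le> \<alpha>1 * N + \<alpha>2 * max_branching B N" .
    qed
  qed
  then show ?thesis
  proof (intro conjI)
    assume inf: "AE \<omega> in M. (\<Sum>k. T k \<omega>) = \<infinity>"
    then show "AE \<omega> in M. \<forall>t\<ge>0. finite {n. 0 < n \<and> jump_time T n \<omega> \<le> ennreal t}"
      by eventually_elim (blast intro: finitely_many_jumps)
    show "AE \<omega> in M. \<forall>t>0. \<exists>y\<in>configs. jump_path X T t \<omega> = Some y"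
      using inf AE_space
    proof eventually_elim
      case (elim \<omega>)
      then show ?case
        by (metis jump_path_eq_Some P.X_in_states)
    qed
  qed
qed

end
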